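(* There is an absolute constant $C>0$ such that for every integer $d\ge 2$ and every $d$-dimensional $o$-symmetric convex body $K\subset\mathbb{R}^d$, \[\kappa'(K)\le\kappa(K)\le C\,3^d\,d\log d .\]
   Context: A convex body in $\mathbb{R}^d$ is a compact convex set with non-empty interior; it is $o$-symmetric if $K=-K$. A (positive) homothet of $K$ is a set $\lambda K+v=\{\lambda k+v: k\in K\}$ with $\lambda>0$, $v\in\mathbb{R}^d$; its center is $v$. A Minkowski arrangement of an $o$-symmetric convex body $K$ is a family $\{v_i+\lambda_iK\}$ of positive homothets of $K$ such that no homothet contains the center of another homothet in its interior, i.e. $v_i\notin v_j+\lambda_j\,\mathrm{int}(K)$ for all $i\ne j$. A strict Minkowski arrangement is such a family with $v_i\notin v_j+\lambda_jK$ for all $i\neq j$. A family is pairwise intersecting if any two of its members intersect. $\kappa(K)$ (resp. $\kappa'(K)$) denotes the largest number of homothets in a pairwise intersecting Minkowski arrangement (resp. strict Minkowski arrangement) of $K$. *)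

theory Defs
  imports "HOL-Analysis.Analysis"
begin

text \<open>Euclidean d-space R^d is represented uniformly in d as the set of real
sequences vanishing from index d on; topology is the (product) topology of
nat => real restricted to this set, which agrees with the Euclidean topology.\<close>

definition Rd :: "nat \<Rightarrow> (nat \<Rightarrow> real) set" where
  "Rd d = {x. \<forall>i\<ge>d. x i = 0}"

definition int_d :: "nat \<Rightarrow> (nat \<Rightarrow> real) set \<Rightarrow> (nat \<Rightarrow> real) set" where
  "int_d d K = {x. \<exists>U. openin (top_of_set (Rd d)) U \<and> x \<in> U \<and> U \<subseteq> K}"

definition convex_d :: "(nat \<Rightarrow> real) set \<Rightarrow> bool" where
  "convex_d K \<longleftrightarrow> (\<forall>x\<in>K. \<forall>y\<in>K. \<forall>t::real. 0 \<le> t \<and> t \<le> 1 \<longrightarrow>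
      (\<lambda>i. (1 - t) * x i + t * y i) \<in> K)"

definition convex_body :: "nat \<Rightarrow> (nat \<Rightarrow> real) set \<Rightarrow> bool" where
  "convex_body d K \<longleftrightarrow> K \<subseteq> Rd d \<and> compact K \<and> convex_d K \<and> int_d d K \<noteq> {}"

definition o_symmetric :: "(nat \<Rightarrow> real) set \<Rightarrow> bool" where
  "o_symmetric K \<longleftrightarrow> K = (\<lambda>x i. - x i) ` K"

definition homothet :: "(nat \<Rightarrow> real) \<Rightarrow> real \<Rightarrow> (nat \<Rightarrow> real) set \<Rightarrow> (nat \<Rightarrow> real) set" where
  "homothet v lam S = (\<lambda>k i. lam * k i + v i) ` S"

definition homothet_family :: "nat \<Rightarrow> 'i set \<Rightarrow> ('i \<Rightarrow> nat \<Rightarrow> real) \<Rightarrow> ('i \<Rightarrow> real) \<Rightarrow> bool" where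
  "homothet_family d I v lam \<longleftrightarrow> (\<forall>i\<in>I. 0 < lam i \<and> v i \<in> Rd d)"

definition minkowski_arr :: "nat \<Rightarrow> (nat \<Rightarrow> real) set \<Rightarrow> 'i set \<Rightarrow> ('i \<Rightarrow> nat \<Rightarrow> real) \<Rightarrow> ('i \<Rightarrow> real) \<Rightarrow> bool" where
  "minkowski_arr d K I v lam \<longleftrightarrow> homothet_family d I v lam \<and>
     (\<forall>i\<in>I. \<forall>j\<in>I. i \<noteq> j \<longrightarrow> v i \<notin> homothet (v j) (lam j) (int_d d K))"

definition strict_minkowski_arr :: "nat \<Rightarrow> (nat \<Rightarrow> real) set \<Rightarrow> 'i set \<Rightarrow> ('i \<Rightarrow> nat \<Rightarrow> real) \<Rightarrow> ('i \<Rightarrow> real) \<Rightarrow> bool" where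
  "strict_minkowski_arr d K I v lam \<longleftrightarrow> homothet_family d I v lam \<and>
     (\<forall>i\<in>I. \<forall>j\<in>I. i \<noteq> j \<longrightarrow> v i \<notin> homothet (v j) (lam j) K)"

definition pairwise_intersecting :: "(nat \<Rightarrow> real) set \<Rightarrow> 'i set \<Rightarrow> ('i \<Rightarrow> nat \<Rightarrow> real) \<Rightarrow> ('i \<Rightarrow> real) \<Rightarrow> bool" where
  "pairwise_intersecting K I v lam \<longleftrightarrow>
     (\<forall>i\<in>I. \<forall>j\<in>I. homothet (v i) (lam i) K \<inter> homothet (v j) (lam j) K \<noteq> {})"

text \<open>kappa and kappa' as suprema (in the extended reals) of the sizes of finite
families; infinite families are covered since all their finite subfamilies qualify.\<close>
definition kappa :: "nat \<Rightarrow> (nat \<Rightarrow> real) set \<Rightarrow> ereal" where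
  "kappa d K = Sup {ereal (real (card I)) | (I :: nat set) v lam.
      finite I \<and> minkowski_arr d K I v lam \<and> pairwise_intersecting K I v lam}"

definition kappa' :: "nat \<Rightarrow> (nat \<Rightarrow> real) set \<Rightarrow> ereal" where
  "kappa' d K = Sup {ereal (real (card I)) | (I :: nat set) v lam.
      finite I \<and> strict_minkowski_arr d K I v lam \<and> pairwise_intersecting K I v lam}"

end

theory Submission
  imports Defs "HOL-Library.Function_Algebras"
begin

text \<open>Let \<open>N\<close> be the norm with unit ball \<open>K\<close>. The centres satisfy
  \<open>max \<lambda>\<^sub>i \<lambda>\<^sub>j \<le> N (v\<^sub>i - v\<^sub>j) \<le> \<lambda>\<^sub>i + \<lambda>\<^sub>j\<close>. The key bound is that a set of diameter \<open>D\<close> with mutual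
  distances at least \<open>s\<close> has at most \<open>(1 + D/s)\<^sup>d\<close> points. Let \<open>\<mu>\<close> be the smallest ratio. Homothets
  with ratio in \<open>[t, t(1 + 1/d)]\<close> have centres with \<open>D/s = 2 + 2/d\<close>, so there are \<open>O(3\<^sup>d)\<close> of them, and
  \<open>O(d log d)\<close> such classes cover the ratios in \<open>[\<mu>, d \<mu>]\<close>. If the ratio exceeds \<open>d \<mu>\<close>, the centres,
  seen from the centre of the smallest homothet and normalised, are unit vectors with mutual
  distances at least \<open>1 - 1/d\<close>, so \<open>D/s = 2 + O(1/d)\<close> and again there are only \<open>O(3\<^sup>d)\<close>.\<close>

section \<open>Sequences as a real vector space\<close>

instantiation "fun" :: (type, real_vector) real_vector
begin

text \<open>Together with the pointwise addition of \<open>Function_Algebras\<close>, this makes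
  \<open>subspace\<close>, \<open>convex\<close> and \<open>convex hull\<close> available for
  \<open>nat \<Rightarrow> real\<close>.\<close>

definition scaleR_fun_def: "scaleR r f = (\<lambda>x. r *\<^sub>R f x)"

instance
  by standard (auto simp: scaleR_fun_def plus_fun_def algebra_simps)

end

lemma scaleR_fun_apply [simp]: "(r *\<^sub>R f) x = r *\<^sub>R f x"
  by (simp add: scaleR_fun_def)

lemma subspace_Rd: "subspace (Rd d)"
  by (auto simp: subspace_def Rd_def)

lemmas Rd_add = subspace_add[OF subspace_Rd]
  and Rd_diff = subspace_diff[OF subspace_Rd]
  and Rd_scale = subspace_scale[OF subspace_Rd]
  and Rd_neg = subspace_neg[OF subspace_Rd]
  and Rd_0 = subspace_0[OF subspace_Rd]

section \<open>Packing by translates\<close>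

text \<open>Pigeonhole on a grid of mesh \<delta>: two points in the same cell differ by at most
  \<delta> in each of the first \<open>d\<close> coordinates.\<close>

lemma card_le_of_separated:
  fixes Y :: "(nat \<Rightarrow> real) set"
  assumes "M \<ge> 0" and "\<delta> > 0"
    and bound: "\<And>y i. y \<in> Y \<Longrightarrow> i < d \<Longrightarrow> \<bar>y i\<bar> \<le> M"
    and sep: "\<And>x y. x \<in> Y \<Longrightarrow> y \<in> Y \<Longrightarrow> x \<noteq> y \<Longrightarrow> \<exists>i<d. \<bar>x i - y i\<bar> > \<delta>"
  shows "real (card Y) \<le> (2 * M / \<delta> + 3) ^ d"
proof -
  \<comment> \<open>The extra 1 lets \<open>{-k..k}\<close> contain every rounded coordinate, while
    \<open>2 * k + 1\<close> is still at most \<open>2 * M / \<delta> + 3\<close>.\<close>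
  define k where "k = \<lfloor>M / \<delta>\<rfloor> + 1"
  have k: "k \<ge> 0" "real_of_int k \<le> M / \<delta> + 1" "M / \<delta> < k"
    using assms(1,2) by (auto simp: k_def)
  define f where "f y = restrict (\<lambda>i. \<lfloor>y i / \<delta>\<rfloor>) {..<d}" for y :: "nat \<Rightarrow> real"
  have "f ` Y \<subseteq> {..<d} \<rightarrow>\<^sub>E {-k..k}"
  proof (clarsimp simp: f_def)
    fix y i assume "y \<in> Y" "i < d"
    with bound have "\<bar>y i\<bar> / \<delta> \<le> M / \<delta>"
      using \<open>\<delta> > 0\<close> by (simp add: divide_right_mono)
    then have "\<bar>y i / \<delta>\<bar> \<le> M / \<delta>"
      using \<open>\<delta> > 0\<close> by simp
    with k show "- k \<le> \<lfloor>y i / \<delta>\<rfloor> \<and> \<lfloor>y i / \<delta>\<rfloor> \<le> k"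
      by linarith
  qed
  moreover have "inj_on f Y"
  proof (rule inj_onI, rule ccontr)
    fix x y assume xy: "x \<in> Y" "y \<in> Y" "f x = f y" "x \<noteq> y"
    then obtain i where i: "i < d" "\<bar>x i - y i\<bar> > \<delta>"
      using sep by blast
    have "f x i = f y i" using xy(3) by simp
    then have "\<bar>x i / \<delta> - y i / \<delta>\<bar> \<le> 1"
      using i(1) unfolding f_def by (simp add: restrict_def) linarith
    then have "\<bar>x i - y i\<bar> / \<delta> \<le> 1"
      using \<open>\<delta> > 0\<close> by (simp add: diff_divide_distrib[symmetric])
    with i(2) \<open>\<delta> > 0\<close> show False by (simp add: field_simps)
  qed
  ultimately have "card Y \<le> card ({..<d} \<rightarrow>\<^sub>E {-k..k})"
    by (metis card_inj_on_le finite_PiE finite_atLeastAtMost_int finite_lessThan)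
  also have "\<dots> = nat (2 * k + 1) ^ d"
    by (simp add: card_PiE algebra_simps)
  finally have "real (card Y) \<le> real (nat (2 * k + 1)) ^ d"
    by (metis of_nat_le_iff of_nat_power)
  also have "\<dots> \<le> (2 * M / \<delta> + 3) ^ d"
    using k by (intro power_mono) auto
  finally show ?thesis .
qed

lemma le_one_if_powers_bounded:
  fixes a C :: real
  assumes "\<And>m. a ^ m \<le> C"
  shows "a \<le> 1"
proof (rule ccontr)
  assume "\<not> a \<le> 1"
  then obtain m where "C < a ^ m"
    using real_arch_pow[of a C] by auto
  with assms[of m] show False by simp
qed

text \<open>Tensor power trick: iterating the packing yields \<open>(card X)\<^sup>m\<close> disjoint translates of \<open>Q\<close> inside
  \<open>\<rho>\<^sup>m Q\<close>. A crude count of separated points, whose constant disappears as \<open>m \<rightarrow> \<infinity>\<close>, then replaces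
  the comparison of volumes.\<close>

lemma iterated_packing:
  fixes X Q :: "'a::real_vector set"
  assumes "finite X" and "\<rho> \<noteq> 0" and "subspace S" and "X \<subseteq> S" and Q: "Q \<noteq> {}"
    and disj: "\<And>x y p q. x \<in> X \<Longrightarrow> y \<in> X \<Longrightarrow> p \<in> Q \<Longrightarrow> q \<in> Q \<Longrightarrow> x + p = y + q \<Longrightarrow> x = y"
    and sub: "\<And>x q. x \<in> X \<Longrightarrow> q \<in> Q \<Longrightarrow> x + q \<in> (*\<^sub>R) \<rho> ` Q"
  obtains Y where "card Y = card X ^ m" "finite Y" "Y \<subseteq> S"
    "\<And>x y p q. x \<in> Y \<Longrightarrow> y \<in> Y \<Longrightarrow> p \<in> Q \<Longrightarrow> q \<in> Q \<Longrightarrow> x + p = y + q \<Longrightarrow> x = y"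
    "\<And>x q. x \<in> Y \<Longrightarrow> q \<in> Q \<Longrightarrow> x + q \<in> (*\<^sub>R) (\<rho> ^ m) ` Q"
proof -
  have "\<exists>Y. card Y = card X ^ m \<and> finite Y \<and> Y \<subseteq> S \<and>
    (\<forall>x\<in>Y. \<forall>y\<in>Y. \<forall>p\<in>Q. \<forall>q\<in>Q. x + p = y + q \<longrightarrow> x = y) \<and>
    (\<forall>x\<in>Y. \<forall>q\<in>Q. x + q \<in> (*\<^sub>R) (\<rho> ^ m) ` Q)"
  proof (induction m)
    case 0
    show ?case
      using \<open>subspace S\<close> by (intro exI[of _ "{0}"]) (auto simp: subspace_0)
  next
    case (Suc m)
    then obtain Y where Y: "card Y = card X ^ m" "finite Y" "Y \<subseteq> S"
      and disjY: "\<And>x y p q. x \<in> Y \<Longrightarrow> y \<in> Y \<Longrightarrow> p \<in> Q \<Longrightarrow> q \<in> Q \<Longrightarrow> x + p = y + q \<Longrightarrow> x = y"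
      and subY: "\<And>x q. x \<in> Y \<Longrightarrow> q \<in> Q \<Longrightarrow> x + q \<in> (*\<^sub>R) (\<rho> ^ m) ` Q"
      by blast
    \<comment> \<open>Each translate \<open>x + Q\<close>, scaled by \<open>\<rho> ^ m\<close>,
      receives a copy of the packing \<open>Y\<close>, which fits into \<open>Q\<close> scaled by
      \<open>\<rho> ^ m\<close>.\<close>
    define f where "f = (\<lambda>(x, y). \<rho> ^ m *\<^sub>R x + (y :: 'a))"
    \<comment> \<open>The outer index \<open>x\<close> is recovered first, then \<open>y\<close>.
      With \<open>p = q\<close> this gives injectivity of \<open>f\<close>, in general disjointness
      of the new translates.\<close>
    have key: "x = x' \<and> y = y'"
      if asm: "x \<in> X" "x' \<in> X" "y \<in> Y" "y' \<in> Y" "p \<in> Q" "q \<in> Q" "f (x, y) + p = f (x', y') + q"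
      for x x' y y' p q
    proof -
      obtain p' q' where p': "p' \<in> Q" "y + p = \<rho> ^ m *\<^sub>R p'" and q': "q' \<in> Q" "y' + q = \<rho> ^ m *\<^sub>R q'"
        using subY[OF asm(3,5)] subY[OF asm(4,6)] by blast
      have "\<rho> ^ m *\<^sub>R (x + p') = \<rho> ^ m *\<^sub>R (x' + q')"
        using that(7) p' q' by (simp add: f_def scaleR_add_right add.assoc)
      then have "x + p' = x' + q'"
        using \<open>\<rho> \<noteq> 0\<close> by simp
      with disj that p' q' have "x = x'" by blast
      with that(7) have "y + p = y' + q" by (simp add: f_def add.assoc)
      with disjY that \<open>x = x'\<close> show ?thesis by blast
    qed
    have f_sub: "f (x, y) + q \<in> (*\<^sub>R) (\<rho> ^ Suc m) ` Q" if asm: "x \<in> X" "y \<in> Y" "q \<in> Q" for x y q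
    proof -
      obtain q' where q': "q' \<in> Q" "y + q = \<rho> ^ m *\<^sub>R q'"
        using subY[of y q] asm by blast
      obtain q'' where q'': "q'' \<in> Q" "x + q' = \<rho> *\<^sub>R q''"
        using sub[of x q'] asm q' by blast
      have "f (x, y) + q = \<rho> ^ m *\<^sub>R (x + q')"
        using q' by (simp add: f_def scaleR_add_right add.assoc)
      also have "\<dots> = \<rho> ^ Suc m *\<^sub>R q''"
        using q'' by (simp add: mult.commute)
      finally show ?thesis using q'' by blast
    qed
    have "inj_on f (X \<times> Y)"
      using key Q by (fastforce simp: inj_on_def)
    then have "card (f ` (X \<times> Y)) = card X ^ Suc m"
      using Y by (simp add: card_image card_cartesian_product)
    moreover have "f ` (X \<times> Y) \<subseteq> S"
      using Y \<open>X \<subseteq> S\<close> \<open>subspace S\<close> by (auto simp: f_def intro!: subspace_add subspace_scale)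
    moreover have "x = y" if asm: "x \<in> f ` (X \<times> Y)" "y \<in> f ` (X \<times> Y)" "p \<in> Q" "q \<in> Q" "x + p = y + q"
      for x y p q
    proof -
      obtain x1 x2 y1 y2 where *: "x = f (x1, x2)" "y = f (y1, y2)" "x1 \<in> X" "x2 \<in> Y" "y1 \<in> X" "y2 \<in> Y"
        using asm(1,2) by (elim imageE SigmaE) simp
      with key[of x1 y1 x2 y2 p q] asm(3-) show ?thesis by simp
    qed
    moreover have "finite (f ` (X \<times> Y))"
      using Y \<open>finite X\<close> by simp
    moreover have "x + q \<in> (*\<^sub>R) (\<rho> ^ Suc m) ` Q" if asm: "x \<in> f ` (X \<times> Y)" "q \<in> Q" for x q
      using asm(1)
    proof (elim imageE SigmaE)
      fix z x1 x2 assume "x = f z" "x1 \<in> X" "x2 \<in> Y" "z = (x1, x2)"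
      with f_sub[of x1 x2 q] asm(2) show ?thesis by simp
    qed
    ultimately show ?case
      by (intro exI[of _ "f ` (X \<times> Y)"] conjI ballI impI)
  qed
  with that show thesis by blast
qed

text \<open>In the \<open>m\<close>-fold iterated packing, the box inside \<open>Q\<close> forces
  the translation vectors to be \<delta>-separated, so there are at most
  \<open>(C * \<rho> ^ m) ^ d\<close> of them, with \<open>C\<close> independent of
  \<open>m\<close>. Dividing by the powers of \<rho> and letting \<open>m\<close> grow removes
  \<open>C\<close>.\<close>

lemma card_packing_le_power:
  fixes X Q :: "(nat \<Rightarrow> real) set"
  assumes "finite X" and "X \<subseteq> Rd d" and "\<rho> \<ge> 1" and "\<delta> > 0"
    and disj: "\<And>x y p q. x \<in> X \<Longrightarrow> y \<in> X \<Longrightarrow> p \<in> Q \<Longrightarrow> q \<in> Q \<Longrightarrow> x + p = y + q \<Longrightarrow> x = y"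
    and sub: "\<And>x q. x \<in> X \<Longrightarrow> q \<in> Q \<Longrightarrow> x + q \<in> (*\<^sub>R) \<rho> ` Q"
    and box: "\<And>y. y \<in> Rd d \<Longrightarrow> (\<And>i. i < d \<Longrightarrow> \<bar>y i\<bar> \<le> \<delta>) \<Longrightarrow> c + y \<in> Q"
    and bound: "\<And>q i. q \<in> Q \<Longrightarrow> i < d \<Longrightarrow> \<bar>q i\<bar> \<le> R"
  shows "real (card X) \<le> \<rho> ^ d"
proof -
  have "c \<in> Q"
    using box[of 0] \<open>\<delta> > 0\<close> by (simp add: Rd_0)
  \<comment> \<open>For \<open>d = 0\<close> the bound is vacuous and \<open>R\<close> may be
    negative; the maximum keeps the products below monotone.\<close>
  define R' where "R' = max R 0"
  have R': "R' \<ge> 0" "\<And>q i. q \<in> Q \<Longrightarrow> i < d \<Longrightarrow> \<bar>q i\<bar> \<le> R'"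
    using bound by (auto simp: R'_def intro: max.coboundedI1)
  define C where "C = 4 * R' / \<delta> + 3"
  have main: "real (card X) ^ m \<le> (C * \<rho> ^ m) ^ d" for m
  proof -
    obtain Y where Y: "card Y = card X ^ m" "Y \<subseteq> Rd d"
      and disjY: "\<And>x y p q. x \<in> Y \<Longrightarrow> y \<in> Y \<Longrightarrow> p \<in> Q \<Longrightarrow> q \<in> Q \<Longrightarrow> x + p = y + q \<Longrightarrow> x = y"
      and subY: "\<And>x q. x \<in> Y \<Longrightarrow> q \<in> Q \<Longrightarrow> x + q \<in> (*\<^sub>R) (\<rho> ^ m) ` Q"
      using iterated_packing[of X \<rho> "Rd d" Q m thesis] assms \<open>c \<in> Q\<close> subspace_Rd by force
    have r: "\<rho> ^ m \<ge> 1"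
      using \<open>\<rho> \<ge> 1\<close> by (rule one_le_power)
    have "real (card Y) \<le> (2 * (2 * R' * \<rho> ^ m) / \<delta> + 3) ^ d"
    proof (rule card_le_of_separated)
      show "0 \<le> 2 * R' * \<rho> ^ m" "\<delta> > 0"
        using R'(1) \<open>\<rho> \<ge> 1\<close> \<open>\<delta> > 0\<close> by auto
    next
      fix y i assume y: "y \<in> Y" "i < d"
      then obtain q where q: "q \<in> Q" "y + c = \<rho> ^ m *\<^sub>R q"
        using subY \<open>c \<in> Q\<close> by blast
      have "y i + c i = \<rho> ^ m * q i"
        using fun_cong[OF q(2), of i] by simp
      then have "\<bar>y i\<bar> \<le> \<rho> ^ m * \<bar>q i\<bar> + \<bar>c i\<bar>"
        using r abs_triangle_ineq4[of "\<rho> ^ m * q i" "c i"] \<open>\<rho> \<ge> 1\<close> by (simp add: abs_mult algebra_simps)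
      also have "\<dots> \<le> \<rho> ^ m * R' + \<rho> ^ m * R'"
      proof (rule add_mono)
        show "\<rho> ^ m * \<bar>q i\<bar> \<le> \<rho> ^ m * R'"
          using r R'(2)[OF q(1) y(2)] by (intro mult_left_mono) auto
        show "\<bar>c i\<bar> \<le> \<rho> ^ m * R'"
          using R'(2)[OF \<open>c \<in> Q\<close> y(2)] mult_right_mono[OF r R'(1)] by simp
      qed
      finally show "\<bar>y i\<bar> \<le> 2 * R' * \<rho> ^ m" by (simp add: mult.commute mult.left_commute)
    next
      fix x y assume xy: "x \<in> Y" "y \<in> Y" "x \<noteq> y"
      show "\<exists>i<d. \<bar>x i - y i\<bar> > \<delta>"
      proof (rule ccontr)
        assume "\<not> ?thesis"
        then have "\<bar>y i - x i\<bar> \<le> \<delta>" if "i < d" for i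
          using that by (force simp: abs_minus_commute)
        \<comment> \<open>Then \<open>x + (c + (y - x)) = y + c\<close> is a common point of the
          translates at \<open>x\<close> and \<open>y\<close>.\<close>
        then have "c + (y - x) \<in> Q"
          using xy \<open>Y \<subseteq> Rd d\<close> by (intro box Rd_diff) auto
        then show False
          using disjY[OF xy(1,2) _ \<open>c \<in> Q\<close>, of "c + (y - x)"] xy(3) by simp
      qed
    qed
    \<comment> \<open>As \<open>\<rho> ^ m\<close> is at least 1, it may multiply the additive 3 as
      well.\<close>
    also have "\<dots> \<le> (C * \<rho> ^ m) ^ d"
    proof (rule power_mono)
      show "2 * (2 * R' * \<rho> ^ m) / \<delta> + 3 \<le> C * \<rho> ^ m"
        using r by (simp add: C_def algebra_simps)
      show "0 \<le> 2 * (2 * R' * \<rho> ^ m) / \<delta> + 3"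
        using R'(1) \<open>\<rho> \<ge> 1\<close> \<open>\<delta> > 0\<close> by auto
    qed
    finally show ?thesis by (simp add: Y)
  qed
  have "real (card X) / \<rho> ^ d \<le> 1"
  proof (rule le_one_if_powers_bounded)
    fix m
    show "(real (card X) / \<rho> ^ d) ^ m \<le> C ^ d"
      using main[of m] \<open>\<rho> \<ge> 1\<close>
      by (simp add: power_divide divide_le_eq power_mult_distrib power_mult[symmetric] mult.commute)
  qed
  then show ?thesis
    using \<open>\<rho> \<ge> 1\<close> by (simp add: divide_le_eq)
qed

section \<open>Norms on coordinate space\<close>

text \<open>A norm on \<open>Rd d\<close>; its values elsewhere are unconstrained. The last two
  assumptions make it equivalent to the maximum norm, and \<open>coord_le_N\<close> includes
  definiteness.\<close>

locale Rd_norm =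
  fixes d :: nat and N :: "(nat \<Rightarrow> real) \<Rightarrow> real"
  assumes N_add: "x \<in> Rd d \<Longrightarrow> y \<in> Rd d \<Longrightarrow> N (x + y) \<le> N x + N y"
    and N_scale: "x \<in> Rd d \<Longrightarrow> N (r *\<^sub>R x) = \<bar>r\<bar> * N x"
    and N_le_1_near_0: "\<exists>\<delta>>0. \<forall>x\<in>Rd d. (\<forall>i<d. \<bar>x i\<bar> \<le> \<delta>) \<longrightarrow> N x \<le> 1"
    and coord_le_N: "\<exists>R. \<forall>x\<in>Rd d. \<forall>i<d. \<bar>x i\<bar> \<le> R * N x"
begin

lemma N_0: "N 0 = 0"
  using N_scale[of 0 0] by (simp add: Rd_0)

lemma N_uminus: "x \<in> Rd d \<Longrightarrow> N (- x) = N x"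
  using N_scale[of x "-1"] by simp

lemma N_diff: "x \<in> Rd d \<Longrightarrow> y \<in> Rd d \<Longrightarrow> N (x - y) \<le> N x + N y"
  using N_add[of x "- y"] by (simp add: Rd_neg N_uminus)

lemma N_diff_commute: "x \<in> Rd d \<Longrightarrow> y \<in> Rd d \<Longrightarrow> N (x - y) = N (y - x)"
  using N_uminus[of "x - y"] by (simp add: Rd_diff)

lemma N_nonneg: "x \<in> Rd d \<Longrightarrow> 0 \<le> N x"
  using N_diff[of x x] by (simp add: N_0)

lemma N_small:
  assumes "\<epsilon> > 0"
  obtains \<delta> where "\<delta> > 0" "\<And>x. x \<in> Rd d \<Longrightarrow> (\<And>i. i < d \<Longrightarrow> \<bar>x i\<bar> \<le> \<delta>) \<Longrightarrow> N x < \<epsilon>"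
proof -
  obtain \<delta> where \<delta>: "\<delta> > 0" "\<And>x. x \<in> Rd d \<Longrightarrow> (\<And>i. i < d \<Longrightarrow> \<bar>x i\<bar> \<le> \<delta>) \<Longrightarrow> N x \<le> 1"
    using N_le_1_near_0 by blast
  show thesis
  proof
    \<comment> \<open>Half of \<epsilon> turns the non-strict bound on \<open>N\<close> into a
      strict one.\<close>
    show "\<delta> * (\<epsilon> / 2) > 0"
      using \<delta> assms by simp
    fix x assume x: "x \<in> Rd d" "\<And>i. i < d \<Longrightarrow> \<bar>x i\<bar> \<le> \<delta> * (\<epsilon> / 2)"
    have "N ((2 / \<epsilon>) *\<^sub>R x) \<le> 1"
    proof (rule \<delta>(2))
      show "(2 / \<epsilon>) *\<^sub>R x \<in> Rd d"
        using x by (rule_tac Rd_scale)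
      show "\<bar>((2 / \<epsilon>) *\<^sub>R x) i\<bar> \<le> \<delta>" if "i < d" for i
        using x(2)[OF that] assms by (simp add: abs_mult field_simps)
    qed
    then have "2 / \<epsilon> * N x \<le> 1"
      using x assms by (simp add: N_scale)
    then show "N x < \<epsilon>"
      using assms by (simp add: field_simps)
  qed
qed

section \<open>Cardinality from diameter and separation\<close>

lemma diff_hull_le:
  assumes "X \<subseteq> Rd d" and diam: "\<And>x y. x \<in> X \<Longrightarrow> y \<in> X \<Longrightarrow> N (x - y) \<le> D"
    and "p \<in> convex hull X" "q \<in> convex hull X"
  shows "N (p - q) \<le> D"
proof -
  \<comment> \<open>Balls of radius \<open>D\<close> are convex. Those around points of
    \<open>X\<close> contain the hull; by symmetry a ball around any point of the hull contains
    \<open>X\<close>, and hence the hull too.\<close>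
  define S where "S y = {p \<in> Rd d. N (p - y) \<le> D}" for y
  have conv: "convex (S y)" if "y \<in> Rd d" for y
  proof (rule convexI)
    fix p q and u v :: real
    assume *: "p \<in> S y" "q \<in> S y" "0 \<le> u" "0 \<le> v" "u + v = 1"
    then have in_Rd: "p \<in> Rd d" "q \<in> Rd d" "p - y \<in> Rd d" "q - y \<in> Rd d"
      using that by (auto simp: S_def Rd_diff)
    have "u *\<^sub>R p + v *\<^sub>R q - y = u *\<^sub>R p + v *\<^sub>R q - (u + v) *\<^sub>R y"
      using * by simp
    also have "\<dots> = u *\<^sub>R (p - y) + v *\<^sub>R (q - y)"
      by (simp add: scaleR_diff_right scaleR_add_left)
    finally have "N (u *\<^sub>R p + v *\<^sub>R q - y) \<le> u * N (p - y) + v * N (q - y)"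
      using N_add[of "u *\<^sub>R (p - y)" "v *\<^sub>R (q - y)"] in_Rd * by (simp add: N_scale Rd_scale)
    also have "\<dots> \<le> D"
      using * by (intro convex_bound_le) (auto simp: S_def)
    finally show "u *\<^sub>R p + v *\<^sub>R q \<in> S y"
      using in_Rd by (simp add: S_def Rd_add Rd_scale)
  qed
  have "convex hull X \<subseteq> S y" if "y \<in> X" for y
    using that assms by (intro hull_minimal conv) (auto simp: S_def)
  then have "convex hull X \<subseteq> S p" if "p \<in> convex hull X" for p
  proof -
    have pRd: "p \<in> Rd d"
      using that assms(1) subspace_imp_convex[OF subspace_Rd] hull_minimal[of X "Rd d" convex] by blast
    have "X \<subseteq> S p"
    proof
      fix y assume "y \<in> X"
      then have "N (p - y) \<le> D" "y \<in> Rd d"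
        using that \<open>X \<subseteq> Rd d\<close> \<open>\<And>y. y \<in> X \<Longrightarrow> convex hull X \<subseteq> S y\<close> by (auto simp: S_def)
      then show "y \<in> S p"
        using pRd N_diff_commute[of p y] by (simp add: S_def)
    qed
    with conv[OF pRd] show ?thesis by (intro hull_minimal)
  qed
  with assms(3,4) have "p \<in> S q" by blast
  then show ?thesis by (simp add: S_def)
qed

text \<open>The translates of \<open>a\<cdot>conv X\<close>, slightly thickened to have interior, by the points of \<open>X\<close>
  are disjoint and lie in \<open>(1 + a)\<cdot>conv X\<close>, thickened likewise. This replaces the isodiametric
  inequality.\<close>

lemma card_le_diam_sep_aux:
  assumes "finite X" "X \<noteq> {}" "X \<subseteq> Rd d" "a > 0" "a * D < s"
    and diam: "\<And>x y. x \<in> X \<Longrightarrow> y \<in> X \<Longrightarrow> N (x - y) \<le> D"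
    and sep: "\<And>x y. x \<in> X \<Longrightarrow> y \<in> X \<Longrightarrow> x \<noteq> y \<Longrightarrow> s \<le> N (x - y)"
  shows "real (card X) \<le> (1 + 1 / a) ^ d"
proof -
  \<comment> \<open>Two translates together lose less than \<open>2 * \<epsilon>\<close> to the
    thickening, exactly the slack between \<open>a * D\<close> and \<open>s\<close>.\<close>
  define \<epsilon> where "\<epsilon> = (s - a * D) / 2"
  have \<epsilon>: "\<epsilon> > 0" "a * D + 2 * \<epsilon> = s"
    using \<open>a * D < s\<close> by (simp_all add: \<epsilon>_def field_simps)
  define P where "P = convex hull X"
  define Q where "Q = {a *\<^sub>R p + b |p b. p \<in> P \<and> b \<in> Rd d \<and> N b < \<epsilon>}"
  have P: "convex P" "X \<subseteq> P"
    by (auto simp: P_def hull_subset)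
  have PRd: "P \<subseteq> Rd d"
    unfolding P_def using assms(3) by (intro hull_minimal) (auto intro: subspace_imp_convex subspace_Rd)
  have Pdiam: "N (p - q) \<le> D" if "p \<in> P" "q \<in> P" for p q
    using diff_hull_le[OF assms(3) diam] that by (simp add: P_def)
  obtain x0 where x0: "x0 \<in> X"
    using assms(2) by blast
  have x0': "x0 \<in> P" "x0 \<in> Rd d"
    using x0 P PRd by auto
  obtain \<delta> where \<delta>: "\<delta> > 0" "\<And>x. x \<in> Rd d \<Longrightarrow> (\<And>i. i < d \<Longrightarrow> \<bar>x i\<bar> \<le> \<delta>) \<Longrightarrow> N x < \<epsilon>"
    using N_small[OF \<epsilon>(1)] by blast
  obtain R where R: "\<And>x i. x \<in> Rd d \<Longrightarrow> i < d \<Longrightarrow> \<bar>x i\<bar> \<le> R * N x"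
    using coord_le_N by blast
  \<comment> \<open>The ratio \<open>1 + 1 / a\<close> is the quotient of the factors
    \<open>1 + a\<close> and \<open>a\<close> in front of \<open>P\<close>.\<close>
  show ?thesis
  proof (rule card_packing_le_power)
    show "finite X" "X \<subseteq> Rd d" "\<delta> > 0" "1 + 1 / a \<ge> 1"
      using assms \<delta> by auto
  next
    fix x y q q' assume *: "x \<in> X" "y \<in> X" "q \<in> Q" "q' \<in> Q" "x + q = y + q'"
    then obtain p b p' b' where q: "q = a *\<^sub>R p + b" "p \<in> P" "b \<in> Rd d" "N b < \<epsilon>"
      and q': "q' = a *\<^sub>R p' + b'" "p' \<in> P" "b' \<in> Rd d" "N b' < \<epsilon>"
      unfolding Q_def by blast
    have in_Rd: "p \<in> Rd d" "p' \<in> Rd d" using q q' PRd by auto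
    have "x - y = q' - q"
      using *(5) by (simp add: algebra_simps)
    also have "\<dots> = a *\<^sub>R (p' - p) + (b' - b)"
      by (simp add: q q' scaleR_diff_right)
    finally have "N (x - y) \<le> N (a *\<^sub>R (p' - p)) + N (b' - b)"
      using N_add[of "a *\<^sub>R (p' - p)" "b' - b"] in_Rd q q' by (simp add: Rd_diff Rd_scale)
    also have "\<dots> \<le> a * D + (N b' + N b)"
      using in_Rd q q' \<open>a > 0\<close> Pdiam[of p' p] by (intro add_mono N_diff) (auto simp: N_scale Rd_diff)
    also have "\<dots> < s"
      using q q' \<epsilon> by simp
    finally show "x = y"
      using sep * by force
  next
    fix x q assume *: "x \<in> X" "q \<in> Q"
    then obtain p b where q: "q = a *\<^sub>R p + b" "p \<in> P" "b \<in> Rd d" "N b < \<epsilon>"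
      unfolding Q_def by blast
    \<comment> \<open>By convexity \<open>x + a *\<^sub>R p\<close> is \<open>1 + a\<close> times a
      point of \<open>P\<close>. The thickening is scaled up by \<open>1 + 1 / a\<close>, so
      \<open>b\<close> has to be shrunk by that factor.\<close>
    define p' where "p' = (1 / (1 + a)) *\<^sub>R x + (a / (1 + a)) *\<^sub>R p"
    define b' where "b' = (1 / (1 + 1 / a)) *\<^sub>R b"
    have "p' \<in> P"
      unfolding p'_def using P q * \<open>a > 0\<close> by (intro convexD) (auto simp: add_divide_distrib[symmetric])
    moreover have "b' \<in> Rd d" "N b' < \<epsilon>"
    proof -
      show "b' \<in> Rd d" unfolding b'_def using q by (intro Rd_scale)
      have "N b' \<le> 1 * N b"
        unfolding b'_def N_scale[OF q(3)] using N_nonneg[OF q(3)] \<open>a > 0\<close>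
        by (intro mult_right_mono) (auto simp: field_simps)
      with q show "N b' < \<epsilon>" by simp
    qed
    moreover have "x + q = (1 + 1 / a) *\<^sub>R (a *\<^sub>R p' + b')"
    proof -
      have "(1 + 1 / a) *\<^sub>R (a *\<^sub>R p') = (1 + a) *\<^sub>R p'"
        using \<open>a > 0\<close> by (simp add: distrib_right)
      also have "\<dots> = x + a *\<^sub>R p"
        using \<open>a > 0\<close> by (simp add: p'_def scaleR_add_right)
      finally show ?thesis
        using \<open>a > 0\<close> unfolding scaleR_add_right b'_def q by (simp add: add_pos_pos less_imp_neq[symmetric] add.assoc)
    qed
    ultimately show "x + q \<in> (*\<^sub>R) (1 + 1 / a) ` Q"
      unfolding Q_def by blast
  next
    fix y assume "y \<in> Rd d" "\<And>i. i < d \<Longrightarrow> \<bar>y i\<bar> \<le> \<delta>"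
    with \<delta> x0' show "a *\<^sub>R x0 + y \<in> Q"
      unfolding Q_def by blast
  next
    fix q i assume "q \<in> Q" "i < d"
    then obtain p b where q: "q = a *\<^sub>R p + b" "p \<in> P" "b \<in> Rd d" "N b < \<epsilon>"
      unfolding Q_def by blast
    then have p: "p \<in> Rd d" using PRd by auto
    have "N p \<le> N (p - x0) + N x0"
      using N_add[of "p - x0" x0] p x0' by (simp add: Rd_diff)
    also have "\<dots> \<le> D + N x0"
      using Pdiam q x0' by simp
    finally have "a * N p \<le> a * (D + N x0)"
      using \<open>a > 0\<close> by simp
    moreover have "N q \<le> a * N p + N b"
      using N_add[of "a *\<^sub>R p" b] q p \<open>a > 0\<close> by (simp add: N_scale Rd_scale)
    ultimately have "N q \<le> a * (D + N x0) + \<epsilon>"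
      using q by simp
    moreover have qRd: "q \<in> Rd d"
      using q p by (simp add: Rd_add Rd_scale)
    ultimately have "R * N q \<le> \<bar>R\<bar> * (a * (D + N x0) + \<epsilon>)"
      using N_nonneg[of q] by (intro mult_mono) auto
    with R[OF qRd \<open>i < d\<close>] show "\<bar>q i\<bar> \<le> \<bar>R\<bar> * (a * (D + N x0) + \<epsilon>)"
      by linarith
  qed
qed

text \<open>The previous bound needs \<open>a * D < s\<close> strictly; letting \<open>a\<close>
  tend to \<open>s / D\<close> from the left gives the sharp value. Indexed families are covered
  because separation makes \<open>f\<close> injective.\<close>

lemma card_le_diam_sep:
  assumes "finite J" "D > 0" "s > 0"
    and Rd: "\<And>i. i \<in> J \<Longrightarrow> f i \<in> Rd d"
    and diam: "\<And>i j. i \<in> J \<Longrightarrow> j \<in> J \<Longrightarrow> i \<noteq> j \<Longrightarrow> N (f i - f j) \<le> D"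
    and sep: "\<And>i j. i \<in> J \<Longrightarrow> j \<in> J \<Longrightarrow> i \<noteq> j \<Longrightarrow> s \<le> N (f i - f j)"
  shows "real (card J) \<le> (1 + D / s) ^ d"
proof (cases "J = {}")
  case True
  then show ?thesis using assms by simp
next
  case False
  have inj: "inj_on f J"
    using sep \<open>s > 0\<close> N_0 by (force intro!: inj_onI)
  have diam': "N (x - y) \<le> D" if "x \<in> f ` J" "y \<in> f ` J" for x y
    using that diam \<open>D > 0\<close> N_0 by (cases "x = y") auto
  have bound: "real (card J) \<le> (1 + 1 / a) ^ d" if "0 < a" "a < s / D" for a
  proof -
    have "real (card (f ` J)) \<le> (1 + 1 / a) ^ d"
      using that assms(1-3) False Rd sep diam'
      by (intro card_le_diam_sep_aux[where D = D and s = s]) (auto simp: field_simps)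
    then show ?thesis using inj by (simp add: card_image)
  qed
  have "((\<lambda>a. (1 + 1 / a) ^ d) \<longlongrightarrow> (1 + 1 / (s / D)) ^ d) (at_left (s / D))"
    using assms by (intro tendsto_intros) auto
  moreover have "\<forall>\<^sub>F a in at_left (s / D). real (card J) \<le> (1 + 1 / a) ^ d"
    unfolding eventually_at_left_field
    using bound assms by (intro exI[of _ 0]) auto
  ultimately show ?thesis
    using tendsto_lowerbound[of "\<lambda>a. (1 + 1 / a) ^ d" "(1 + D / s) ^ d" "at_left (s / D)" "real (card J)"]
    by simp
qed

section \<open>Counting homothets by their ratios\<close>

lemma normalised_dist_ge:
  assumes "x \<in> Rd d" "y \<in> Rd d" "0 < N x" "N x \<le> N y"
  shows "(N (x - y) - (N y - N x)) / N x \<le> N (inverse (N x) *\<^sub>R x - inverse (N y) *\<^sub>R y)"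
proof -
  \<comment> \<open>Shrinking \<open>y\<close> radially to the norm of \<open>x\<close> moves it by
    \<open>N y - N x\<close>. Afterwards both vectors are normalised by the same factor.\<close>
  define z where "z = (N x / N y) *\<^sub>R y"
  have z: "z \<in> Rd d" unfolding z_def using assms by (intro Rd_scale)
  have "N (x - y) \<le> N (x - z) + N (z - y)"
    using N_add[of "x - z" "z - y"] assms z by (simp add: Rd_diff)
  moreover have "N (z - y) = N y - N x"
  proof -
    have "z - y = (N x / N y - 1) *\<^sub>R y"
      by (simp add: z_def scaleR_diff_left)
    then show ?thesis
      using assms by (simp add: N_scale field_simps abs_if)
  qed
  ultimately have "(N (x - y) - (N y - N x)) / N x \<le> N (x - z) / N x"
    using assms by (intro divide_right_mono) auto
  also have "\<dots> = N (inverse (N x) *\<^sub>R (x - z))"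
    using \<open>0 < N x\<close> by (simp add: N_scale[OF Rd_diff[OF assms(1) z]] divide_inverse mult.commute)
  also have "inverse (N x) *\<^sub>R (x - z) = inverse (N x) *\<^sub>R x - inverse (N y) *\<^sub>R y"
    using assms by (simp add: z_def scaleR_diff_right field_simps)
  finally show ?thesis .
qed

text \<open>The origin plays the centre of a homothet of ratio \<mu>. The normalised centres have
  mutual distances at most 2 and at least \<open>1 - 1 / d\<close>.\<close>

lemma card_far_le:
  fixes \<mu> :: real and lam :: "'i \<Rightarrow> real"
  assumes "finite J" "d \<ge> 2" "\<mu> > 0"
    and Rd: "\<And>i. i \<in> J \<Longrightarrow> v i \<in> Rd d"
    and lam: "\<And>i. i \<in> J \<Longrightarrow> d * \<mu> \<le> lam i"
    and norm: "\<And>i. i \<in> J \<Longrightarrow> lam i \<le> N (v i) \<and> N (v i) \<le> \<mu> + lam i"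
    and sep: "\<And>i j. i \<in> J \<Longrightarrow> j \<in> J \<Longrightarrow> i \<noteq> j \<Longrightarrow> lam j \<le> N (v i - v j)"
  shows "real (card J) \<le> (3 + 2 / (real d - 1)) ^ d"
proof -
  define s where "s = (real d - 1) / real d"
  have "s > 0" using \<open>d \<ge> 2\<close> by (simp add: s_def)
  define u where "u i = inverse (N (v i)) *\<^sub>R v i" for i
  have pos: "0 < N (v i)" if "i \<in> J" for i
  proof -
    have "0 < d * \<mu>" using assms by simp
    with lam[OF that] norm[OF that] show ?thesis by linarith
  qed
  have uRd: "u i \<in> Rd d" if "i \<in> J" for i
    using Rd[OF that] by (simp add: u_def Rd_scale)
  have N_u: "N (u i) = 1" if "i \<in> J" for i
    using pos[OF that] Rd[OF that] by (simp add: u_def N_scale)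
  \<comment> \<open>With \<open>v i\<close> the shorter vector, the radial loss is at most
    \<open>\<mu> + lam j - N (v i)\<close>, which leaves \<open>N (v i) - \<mu>\<close> of the
    separation \<open>lam j\<close>; here \<mu> is at most \<open>N (v i) / d\<close>. The other
    order follows by symmetry.\<close>
  have usep: "s \<le> N (u i - u j)" if ij: "i \<in> J" "j \<in> J" "i \<noteq> j" "N (v i) \<le> N (v j)" for i j
  proof -
    have "real d * \<mu> \<le> N (v i)" "N (v j) \<le> \<mu> + lam j" "lam j \<le> N (v i - v j)"
      using norm[OF ij(1)] norm[OF ij(2)] lam[OF ij(1)] sep[OF ij(1-3)] by auto
    moreover from this(1) have "s * N (v i) \<le> N (v i) - \<mu>"
      using \<open>d \<ge> 2\<close> by (simp add: s_def field_simps)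
    ultimately have "s * N (v i) \<le> N (v i - v j) - (N (v j) - N (v i))"
      by linarith
    then have "s \<le> (N (v i - v j) - (N (v j) - N (v i))) / N (v i)"
      using pos[OF ij(1)] by (simp add: le_divide_eq)
    also have "\<dots> \<le> N (u i - u j)"
      unfolding u_def using Rd ij pos by (intro normalised_dist_ge) auto
    finally show ?thesis .
  qed
  have "real (card J) \<le> (1 + 2 / s) ^ d"
  proof (rule card_le_diam_sep)
    show "u i \<in> Rd d" if "i \<in> J" for i using uRd that .
    show "N (u i - u j) \<le> 2" if "i \<in> J" "j \<in> J" for i j
      using N_diff[of "u i" "u j"] N_u uRd that by simp
    show "s \<le> N (u i - u j)" if "i \<in> J" "j \<in> J" "i \<noteq> j" for i j
      using usep[of i j] usep[of j i] that N_diff_commute[of "u i" "u j"] uRd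
      by (cases "N (v i) \<le> N (v j)") auto
  qed (use assms \<open>s > 0\<close> in auto)
  also have "1 + 2 / s = 3 + 2 / (real d - 1)"
    using \<open>d \<ge> 2\<close> by (simp add: s_def field_simps)
  finally show ?thesis .
qed

text \<open>Distances of distinct centres lie between \<mu> and
  \<open>2 * \<mu> * (1 + 1 / d)\<close>, so diameter over separation is at most
  \<open>2 + 2 / d\<close>.\<close>

lemma card_similar_le:
  fixes \<mu> :: real and lam :: "'i \<Rightarrow> real"
  assumes "finite J" "d \<ge> 2" "\<mu> > 0"
    and Rd: "\<And>i. i \<in> J \<Longrightarrow> v i \<in> Rd d"
    and lam: "\<And>i. i \<in> J \<Longrightarrow> \<mu> \<le> lam i \<and> lam i \<le> \<mu> * (1 + 1 / d)"
    and diam: "\<And>i j. i \<in> J \<Longrightarrow> j \<in> J \<Longrightarrow> N (v i - v j) \<le> lam i + lam j"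
    and sep: "\<And>i j. i \<in> J \<Longrightarrow> j \<in> J \<Longrightarrow> i \<noteq> j \<Longrightarrow> lam j \<le> N (v i - v j)"
  shows "real (card J) \<le> (3 + 2 / real d) ^ d"
proof -
  have "real (card J) \<le> (1 + (2 * (\<mu> * (1 + 1 / d))) / \<mu>) ^ d"
  proof (rule card_le_diam_sep)
    show "v i \<in> Rd d" if "i \<in> J" for i using Rd that .
    show "N (v i - v j) \<le> 2 * (\<mu> * (1 + 1 / d))" if "i \<in> J" "j \<in> J" for i j
      using diam[OF that] lam[OF that(1)] lam[OF that(2)] by simp
    show "\<mu> \<le> N (v i - v j)" if "i \<in> J" "j \<in> J" "i \<noteq> j" for i j
      using sep[OF that] lam[OF that(2)] by simp
    show "0 < 2 * (\<mu> * (1 + 1 / d))"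
      using \<open>\<mu> > 0\<close> by (simp add: add_pos_nonneg)
  qed (use assms in auto)
  also have "1 + (2 * (\<mu> * (1 + 1 / d))) / \<mu> = 3 + 2 / real d"
    using \<open>\<mu> > 0\<close> by (simp add: field_simps)
  finally show ?thesis .
qed

text \<open>The ratios are sorted into geometric classes of quotient \<open>1 + 1 / d\<close>. Each
  class obeys the bound for similar ratios, and a range of quotient \<open>d\<close> meets about
  \<open>d * ln d\<close> classes up to a constant factor.\<close>

lemma card_near_le:
  fixes \<mu> :: real and lam :: "'i \<Rightarrow> real"
  assumes "finite J" "d \<ge> 2" "\<mu> > 0"
    and Rd: "\<And>i. i \<in> J \<Longrightarrow> v i \<in> Rd d"
    and lam: "\<And>i. i \<in> J \<Longrightarrow> \<mu> \<le> lam i \<and> lam i \<le> d * \<mu>"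
    and diam: "\<And>i j. i \<in> J \<Longrightarrow> j \<in> J \<Longrightarrow> N (v i - v j) \<le> lam i + lam j"
    and sep: "\<And>i j. i \<in> J \<Longrightarrow> j \<in> J \<Longrightarrow> i \<noteq> j \<Longrightarrow> lam j \<le> N (v i - v j)"
  shows "real (card J) \<le> (2 * real d * ln (real d) + 1) * (3 + 2 / real d) ^ d"
proof -
  define r where "r = 1 + 1 / real d"
  have "r > 1" using \<open>d \<ge> 2\<close> by (simp add: r_def)
  \<comment> \<open>The class of \<open>i\<close>: its ratio lies between
    \<open>\<mu> * r ^ k i\<close> and \<open>\<mu> * r ^ (k i + 1)\<close>.\<close>
  define k where "k i = nat \<lfloor>log r (lam i / \<mu>)\<rfloor>" for i
  define m where "m = nat \<lfloor>log r (real d)\<rfloor>"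
  have log_nonneg: "0 \<le> log r (lam i / \<mu>)" if "i \<in> J" for i
    using lam[OF that] \<open>\<mu> > 0\<close> \<open>r > 1\<close> by simp
  have pos: "0 < lam i / \<mu>" if "i \<in> J" for i
    using lam[OF that] \<open>\<mu> > 0\<close> by simp
  have k_le: "k i \<le> m" if "i \<in> J" for i
    unfolding k_def m_def using lam[OF that] \<open>\<mu> > 0\<close> \<open>r > 1\<close> pos[OF that] \<open>d \<ge> 2\<close>
    by (intro nat_mono floor_mono) (simp add: field_simps)
  have lam_bounds: "\<mu> * r ^ k i \<le> lam i \<and> lam i \<le> \<mu> * r ^ k i * r" if "i \<in> J" for i
  proof -
    have "real (k i) \<le> log r (lam i / \<mu>)" "log r (lam i / \<mu>) < real (Suc (k i))"
      using log_nonneg[OF that] by (simp_all add: k_def) linarith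
    then have "r powr real (k i) \<le> lam i / \<mu>" "lam i / \<mu> < r powr real (Suc (k i))"
      using pos[OF that] \<open>r > 1\<close> by (simp_all only: le_log_iff log_less_iff)
    then show ?thesis
      using \<open>r > 1\<close> \<open>\<mu> > 0\<close> by (simp only: powr_realpow) (simp add: field_simps)
  qed
  have class_le: "real (card {i \<in> J. k i = n}) \<le> (3 + 2 / real d) ^ d" for n
  proof (rule card_similar_le[where \<mu> = "\<mu> * r ^ n" and v = v and lam = lam])
    show "0 < \<mu> * r ^ n" using \<open>\<mu> > 0\<close> \<open>r > 1\<close> by simp
  qed (use assms lam_bounds in \<open>auto simp: r_def\<close>)
  have "J = (\<Union>n\<le>m. {i \<in> J. k i = n})"
    using k_le by auto
  then have "card J \<le> (\<Sum>n\<le>m. card {i \<in> J. k i = n})"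
    using card_UN_le[of "{..m}" "\<lambda>n. {i \<in> J. k i = n}"] by simp
  then have "real (card J) \<le> (\<Sum>n\<le>m. real (card {i \<in> J. k i = n}))"
    by (metis of_nat_le_iff of_nat_sum)
  also have "\<dots> \<le> (\<Sum>n\<le>m. (3 + 2 / real d) ^ d)"
    by (intro sum_mono class_le)
  also have "\<dots> = (real m + 1) * (3 + 2 / real d) ^ d"
    by simp
  also have "\<dots> \<le> (2 * real d * ln (real d) + 1) * (3 + 2 / real d) ^ d"
  proof (intro mult_right_mono add_mono order.refl)
    \<comment> \<open>A lower bound on \<open>ln r\<close>: \<open>1 / r - 1\<close> equals
      \<open>- 1 / (d + 1)\<close>. This is the source of the factor 2 in the number of
      classes.\<close>
    have "- ln r = ln (1 / r)"
      using \<open>r > 1\<close> by (simp add: ln_div)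
    also have "\<dots> \<le> 1 / r - 1"
      using \<open>r > 1\<close> by (intro ln_le_minus_one) simp
    also have "\<dots> \<le> - (1 / (2 * real d))"
      using \<open>d \<ge> 2\<close> by (simp add: r_def field_simps)
    finally have ln_r: "1 \<le> 2 * real d * ln r"
      using \<open>d \<ge> 2\<close> by (simp add: field_simps)
    have "0 \<le> ln (real d)" "0 < ln r"
      using \<open>d \<ge> 2\<close> \<open>r > 1\<close> by auto
    then have "real m \<le> ln (real d) / ln r"
      by (simp add: m_def log_def)
    also have "\<dots> \<le> 2 * real d * ln (real d)"
      using mult_right_mono[OF ln_r \<open>0 \<le> ln (real d)\<close>] \<open>0 < ln r\<close> by (simp add: divide_le_eq mult_ac)
    finally show "real m \<le> 2 * real d * ln (real d)" .
  qed auto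
  finally show ?thesis .
qed

text \<open>The threshold \<open>d * \<mu>\<close> suits both sides: the near ratios need only
  logarithmically many classes to base \<open>1 + 1 / d\<close>, and for the far ones an error of
  \<mu> is a relative error of \<open>1 / d\<close>.\<close>

lemma card_minkowski_le:
  fixes lam :: "'i \<Rightarrow> real"
  assumes "finite I" "d \<ge> 2"
    and Rd: "\<And>i. i \<in> I \<Longrightarrow> v i \<in> Rd d"
    and lam: "\<And>i. i \<in> I \<Longrightarrow> 0 < lam i"
    and diam: "\<And>i j. i \<in> I \<Longrightarrow> j \<in> I \<Longrightarrow> N (v i - v j) \<le> lam i + lam j"
    and sep: "\<And>i j. i \<in> I \<Longrightarrow> j \<in> I \<Longrightarrow> i \<noteq> j \<Longrightarrow> lam j \<le> N (v i - v j)"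
  shows "real (card I) \<le> 4 * exp 2 * 3 ^ d * real d * ln (real d)"
proof (cases "I = {}")
  case True
  then show ?thesis using \<open>d \<ge> 2\<close> by simp
next
  case False
  then obtain i0 where i0: "i0 \<in> I" "\<And>i. i \<in> I \<Longrightarrow> lam i0 \<le> lam i"
    using arg_min_if_finite[OF \<open>finite I\<close>, of lam] by (metis not_le)
  define \<mu> where "\<mu> = lam i0"
  have "\<mu> > 0" using lam i0 by (simp add: \<mu>_def)
  define near where "near = {i \<in> I. lam i \<le> d * \<mu>}"
  define far where "far = {i \<in> I. d * \<mu> < lam i}"
  define B where "B = 3 ^ d * exp (2 :: real)"
  \<comment> \<open>Covers both counts, since \<open>2 / d\<close> and \<open>2 / (d - 1)\<close>
    are at most \<open>4 / d\<close>. The factor \<open>exp 2\<close> bounds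
    \<open>(1 + 2 / d) ^ d\<close>.\<close>
  have power_le_B: "(3 + x) ^ d \<le> B" if "0 \<le> x" "x \<le> 4 / d" for x :: real
  proof -
    have "(3 + x) ^ d \<le> (3 * (1 + 2 / d)) ^ d"
      using that \<open>d \<ge> 2\<close> by (intro power_mono) (auto simp: field_simps)
    also have "\<dots> = 3 ^ d * (1 + 2 / d) ^ d"
      by (rule power_mult_distrib)
    also have "\<dots> \<le> B"
      unfolding B_def using \<open>d \<ge> 2\<close> by (intro mult_left_mono exp_ge_one_plus_x_over_n_power_n) auto
    finally show ?thesis .
  qed
  have "real (card near) \<le> (2 * real d * ln (real d) + 1) * (3 + 2 / real d) ^ d"
    using assms i0 \<open>\<mu> > 0\<close>
    by (intro card_near_le[where \<mu> = \<mu> and v = v and lam = lam]) (auto simp: near_def \<mu>_def)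
  also have "\<dots> \<le> (2 * real d * ln (real d) + 1) * B"
    using \<open>d \<ge> 2\<close> by (intro mult_left_mono power_le_B) (auto simp: divide_right_mono)
  finally have near_le: "real (card near) \<le> (2 * real d * ln (real d) + 1) * B" .
  \<comment> \<open>The centre of the smallest homothet is moved to the origin. As \<open>d\<close>
    exceeds 1, \<open>i0\<close> itself is not in \<open>far\<close>, so separation applies to each
    far centre and \<open>v i0\<close>.\<close>
  have "real (card far) \<le> (3 + 2 / (real d - 1)) ^ d"
  proof (rule card_far_le[where \<mu> = \<mu> and lam = lam and v = "\<lambda>i. v i - v i0"])
    fix i assume i: "i \<in> far"
    have "\<mu> < d * \<mu>" using \<open>\<mu> > 0\<close> \<open>d \<ge> 2\<close> by simp
    with i have "i \<noteq> i0" "i \<in> I" by (auto simp: far_def \<mu>_def)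
    then show "lam i \<le> N (v i - v i0) \<and> N (v i - v i0) \<le> \<mu> + lam i"
      using diam[of i i0] sep[of i0 i] i0(1) N_diff_commute[of "v i" "v i0"] Rd by (simp add: \<mu>_def)
  next
    fix i assume "i \<in> far"
    then show "v i - v i0 \<in> Rd d" using Rd i0(1) by (auto simp: far_def intro: Rd_diff)
  qed (use assms \<open>\<mu> > 0\<close> in \<open>auto simp: far_def\<close>)
  also have "\<dots> \<le> B"
    using \<open>d \<ge> 2\<close> by (intro power_le_B) (auto simp: field_simps)
  finally have far_le: "real (card far) \<le> B" .
  have "I = near \<union> far" by (auto simp: near_def far_def)
  then have "real (card I) \<le> real (card near) + real (card far)"
    by (metis card_Un_le of_nat_add of_nat_le_iff)
  also have "\<dots> \<le> (2 * (real d * ln (real d)) + 2) * B"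
    using near_le far_le by (simp add: algebra_simps)
  also have "\<dots> \<le> (4 * (real d * ln (real d))) * B"
  proof (intro mult_right_mono)
    \<comment> \<open>The additive 2 is absorbed into the main term, which doubles its coefficient
      to 4.\<close>
    have "(1 :: real) \<le> 2 * ln 2"
      using ln_le_minus_one[of "1 / 2 :: real"] by (simp add: ln_div)
    also have "\<dots> \<le> real d * ln (real d)"
      using \<open>d \<ge> 2\<close> by (intro mult_mono) auto
    finally show "2 * (real d * ln (real d)) + 2 \<le> 4 * (real d * ln (real d))" by simp
  qed (simp add: B_def)
  finally show ?thesis by (simp add: B_def mult_ac)
qed

end

section \<open>The gauge of a symmetric convex body\<close>

lemma convex_d_iff: "convex_d K \<longleftrightarrow> convex K"
proof -
  have "(\<lambda>i. (1 - t) * x i + t * y i) = (1 - t) *\<^sub>R x + t *\<^sub>R y" for x y :: "nat \<Rightarrow> real" and t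
    by (auto simp: fun_eq_iff)
  then show ?thesis
    by (simp add: convex_d_def convex_alt)
qed

lemma homothet_eq: "homothet v lam S = (\<lambda>k. lam *\<^sub>R k + v) ` S"
proof -
  have "(\<lambda>i. lam * k i + v i) = lam *\<^sub>R k + v" for k :: "nat \<Rightarrow> real"
    by (auto simp: fun_eq_iff)
  then show ?thesis by (simp add: homothet_def)
qed

text \<open>A basic open set of the product topology is a product of open sets. Vectors of
  \<open>Rd d\<close> vanish from index \<open>d\<close> on, so only the first \<open>d\<close>
  factors limit the size of the box.\<close>

lemma open_Rd_box:
  assumes "open T" "p \<in> T" "p \<in> Rd d"
  obtains \<delta> where "\<delta> > 0" "\<And>x. x \<in> Rd d \<Longrightarrow> (\<And>i. i < d \<Longrightarrow> \<bar>x i\<bar> \<le> \<delta>) \<Longrightarrow> p + x \<in> T"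
proof -
  have "openin (product_topology (\<lambda>i. euclidean) UNIV) T"
    using \<open>open T\<close> by (simp add: open_fun_def)
  from product_topology_open_contains_basis[OF this \<open>p \<in> T\<close>]
  obtain X where X: "p \<in> Pi\<^sub>E UNIV X" "\<And>i. open (X i)" "Pi\<^sub>E UNIV X \<subseteq> T"
    by auto
  have pX: "p i \<in> X i" for i using X(1) by auto
  have "\<exists>e>0. cball (p i) e \<subseteq> X i" for i
    using X(2) pX open_contains_cball by blast
  then obtain e where e: "\<And>i. e i > 0" "\<And>i. cball (p i) (e i) \<subseteq> X i"
    by metis
  \<comment> \<open>The 1 keeps the minimum defined when \<open>d = 0\<close>.\<close>
  define \<delta> where "\<delta> = Min (insert 1 (e ` {..<d}))"
  show thesis
  proof
    show "\<delta> > 0" using e by (simp add: \<delta>_def)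
    fix x assume x: "x \<in> Rd d" "\<And>i. i < d \<Longrightarrow> \<bar>x i\<bar> \<le> \<delta>"
    have "(p + x) i \<in> X i" for i
    proof (cases "i < d")
      case True
      then have "\<delta> \<le> e i" by (simp add: \<delta>_def)
      with x(2)[OF True] have "p i + x i \<in> cball (p i) (e i)"
        by (simp add: dist_real_def)
      with e(2)[of i] have "p i + x i \<in> X i" by blast
      then show ?thesis by simp
    next
      case False
      with x(1) pX show ?thesis by (simp add: Rd_def)
    qed
    then have "p + x \<in> Pi\<^sub>E UNIV X" by auto
    with X(3) show "p + x \<in> T" by blast
  qed
qed

lemma openin_Rd_box:
  "openin (top_of_set (Rd d)) {x \<in> Rd d. \<forall>i<d. \<bar>x i - p i\<bar> < e}"
proof -
  have "open {x. \<forall>i\<in>{..<d}. x i \<in> ball (p i) e}"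
    by (rule product_topology_basis') auto
  moreover have "{x \<in> Rd d. \<forall>i<d. \<bar>x i - p i\<bar> < e} = Rd d \<inter> {x. \<forall>i\<in>{..<d}. x i \<in> ball (p i) e}"
    by (auto simp: dist_real_def abs_minus_commute)
  ultimately show ?thesis
    by (auto simp: openin_open)
qed

text \<open>Interior and compactness enter as comparisons with coordinate boxes around the origin,
  the form in which \<open>Rd_norm\<close> asks for them.\<close>

locale sym_body =
  fixes d :: nat and K :: "(nat \<Rightarrow> real) set"
  assumes K_Rd: "K \<subseteq> Rd d" and convex_K: "convex K"
    and K_uminus: "x \<in> K \<Longrightarrow> - x \<in> K"
    and K_box: "\<exists>\<delta>>0. \<forall>x\<in>Rd d. (\<forall>i<d. \<bar>x i\<bar> \<le> \<delta>) \<longrightarrow> x \<in> K"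
    and K_bounded: "\<exists>R>0. \<forall>x\<in>K. \<forall>i<d. \<bar>x i\<bar> \<le> R"
begin

text \<open>The Minkowski functional of \<open>K\<close>. It is meaningful on \<open>Rd d\<close>,
  where the set of admissible factors is nonempty; elsewhere the infimum is over the empty
  set.\<close>

definition gauge_K :: "(nat \<Rightarrow> real) \<Rightarrow> real" where
  "gauge_K x = Inf {r. 0 < r \<and> x \<in> (*\<^sub>R) r ` K}"

lemma zero_K: "0 \<in> K"
  using K_box by (auto simp: Rd_0)

lemma mem_scaleI: "k \<in> A \<Longrightarrow> x = r *\<^sub>R k \<Longrightarrow> x \<in> (*\<^sub>R) r ` A"
  by blast

lemma bdd_below_scalings: "bdd_below {r::real. 0 < r \<and> x \<in> (*\<^sub>R) r ` K}"
  by (intro bdd_belowI[of _ 0]) auto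

lemma scale_K_mono:
  assumes "0 < r" "r \<le> s" "x \<in> (*\<^sub>R) r ` K"
  shows "x \<in> (*\<^sub>R) s ` K"
proof -
  obtain k where k: "k \<in> K" "x = r *\<^sub>R k" using assms by blast
  have "(r / s) *\<^sub>R k + (1 - r / s) *\<^sub>R 0 \<in> K"
    using assms k zero_K by (intro convexD[OF convex_K]) auto
  then have "(r / s) *\<^sub>R k \<in> K" by simp
  moreover have "x = s *\<^sub>R ((r / s) *\<^sub>R k)" using assms k by simp
  ultimately show ?thesis by (rule mem_scaleI)
qed

lemma absorbing:
  assumes "x \<in> Rd d"
  shows "\<exists>r>0. x \<in> (*\<^sub>R) r ` K"
proof -
  obtain \<delta> where \<delta>: "\<delta> > 0" "\<And>x. x \<in> Rd d \<Longrightarrow> (\<And>i. i < d \<Longrightarrow> \<bar>x i\<bar> \<le> \<delta>) \<Longrightarrow> x \<in> K"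
    using K_box by blast
  \<comment> \<open>The sum bounds every coordinate, and the 1 keeps it positive for the zero
    vector.\<close>
  define M where "M = (\<Sum>i<d. \<bar>x i\<bar>) + 1"
  have M: "M > 0" by (simp add: M_def add_nonneg_pos sum_nonneg)
  have "(\<delta> / M) *\<^sub>R x \<in> K"
  proof (rule \<delta>(2))
    fix i assume "i < d"
    then have "\<bar>x i\<bar> \<le> M"
      using member_le_sum[of i "{..<d}" "\<lambda>i. \<bar>x i\<bar>"] by (simp add: M_def)
    then show "\<bar>((\<delta> / M) *\<^sub>R x) i\<bar> \<le> \<delta>"
      using M \<delta>(1) by (simp add: abs_mult field_simps)
  qed (use assms in \<open>rule Rd_scale\<close>)
  moreover have "x = (M / \<delta>) *\<^sub>R ((\<delta> / M) *\<^sub>R x)"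
    using M \<delta>(1) by simp
  ultimately have "x \<in> (*\<^sub>R) (M / \<delta>) ` K" by (rule mem_scaleI)
  then show ?thesis
    using M \<delta>(1) by (intro exI[of _ "M / \<delta>"]) simp
qed

lemma gauge_K_le: "0 < r \<Longrightarrow> x \<in> (*\<^sub>R) r ` K \<Longrightarrow> gauge_K x \<le> r"
  unfolding gauge_K_def by (intro cInf_lower bdd_below_scalings) auto

lemma gauge_K_nonneg: "x \<in> Rd d \<Longrightarrow> 0 \<le> gauge_K x"
  unfolding gauge_K_def using absorbing by (intro cInf_greatest) auto

text \<open>The strict bound provides a smaller admissible factor, so it does not matter whether the
  infimum is attained.\<close>

lemma mem_scale_K:
  assumes "x \<in> Rd d" "gauge_K x < r"
  shows "x \<in> (*\<^sub>R) r ` K"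
proof -
  have "{r. 0 < r \<and> x \<in> (*\<^sub>R) r ` K} \<noteq> {}"
    using absorbing[OF assms(1)] by blast
  then obtain s where "0 < s" "s < r" "x \<in> (*\<^sub>R) s ` K"
    using cInf_lessD[OF _ assms(2)[unfolded gauge_K_def]] by auto
  then show ?thesis using scale_K_mono[of s r x] by simp
qed

lemma gauge_K_add:
  assumes "x \<in> Rd d" "y \<in> Rd d"
  shows "gauge_K (x + y) \<le> gauge_K x + gauge_K y"
proof (rule field_le_epsilon)
  fix e :: real assume "e > 0"
  define r s where "r = gauge_K x + e / 2" and "s = gauge_K y + e / 2"
  have rs: "r > 0" "s > 0" "r + s > 0"
    using gauge_K_nonneg[OF assms(1)] gauge_K_nonneg[OF assms(2)] \<open>e > 0\<close> by (simp_all add: r_def s_def)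
  obtain k where k: "k \<in> K" "x = r *\<^sub>R k"
    using mem_scale_K[of x r] assms \<open>e > 0\<close> by (auto simp: r_def)
  obtain l where l: "l \<in> K" "y = s *\<^sub>R l"
    using mem_scale_K[of y s] assms \<open>e > 0\<close> by (auto simp: s_def)
  have "(r / (r + s)) *\<^sub>R k + (s / (r + s)) *\<^sub>R l \<in> K"
    using rs k l by (intro convexD[OF convex_K]) (auto simp: add_divide_distrib[symmetric])
  moreover have "x + y = (r + s) *\<^sub>R ((r / (r + s)) *\<^sub>R k + (s / (r + s)) *\<^sub>R l)"
    using rs by (simp add: k l scaleR_add_right)
  ultimately have "x + y \<in> (*\<^sub>R) (r + s) ` K" by (rule mem_scaleI)
  with rs have "gauge_K (x + y) \<le> r + s" by (intro gauge_K_le)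
  then show "gauge_K (x + y) \<le> gauge_K x + gauge_K y + e"
    by (simp add: r_def s_def)
qed

text \<open>Symmetry of \<open>K\<close> absorbs the sign of \<open>r\<close>, so only its absolute
  value scales the factor.\<close>

lemma gauge_K_scale_le:
  assumes "x \<in> Rd d" "r \<noteq> 0"
  shows "gauge_K (r *\<^sub>R x) \<le> \<bar>r\<bar> * gauge_K x"
proof -
  have "gauge_K (r *\<^sub>R x) / \<bar>r\<bar> \<le> s" if s_gt: "gauge_K x < s" for s
  proof -
    have s: "s > 0" using that gauge_K_nonneg[OF assms(1)] by linarith
    obtain k where k: "k \<in> K" "x = s *\<^sub>R k"
      using mem_scale_K[OF assms(1) s_gt] by blast
    have "sgn r *\<^sub>R k \<in> K"
      using k K_uminus assms(2) by (auto simp: sgn_if)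
    moreover have "r *\<^sub>R x = (\<bar>r\<bar> * s) *\<^sub>R (sgn r *\<^sub>R k)"
      using k by (simp add: sgn_if)
    ultimately have "r *\<^sub>R x \<in> (*\<^sub>R) (\<bar>r\<bar> * s) ` K" by (rule mem_scaleI)
    then have "gauge_K (r *\<^sub>R x) \<le> \<bar>r\<bar> * s"
      using s assms(2) by (intro gauge_K_le) auto
    then show ?thesis using assms(2) by (simp add: divide_le_eq mult.commute)
  qed
  then have "gauge_K (r *\<^sub>R x) / \<bar>r\<bar> \<le> gauge_K x"
    by (rule dense_ge)
  then show ?thesis using assms(2) by (simp add: divide_le_eq mult.commute)
qed

lemma gauge_K_0: "gauge_K 0 = 0"
proof (rule antisym)
  show "gauge_K 0 \<le> 0"
  proof (rule dense_ge)
    fix r :: real assume "0 < r"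
    then show "gauge_K 0 \<le> r"
      using zero_K by (intro gauge_K_le) (auto intro: image_eqI[of _ _ 0])
  qed
qed (simp add: gauge_K_nonneg Rd_0)

lemma gauge_K_scale:
  assumes "x \<in> Rd d"
  shows "gauge_K (r *\<^sub>R x) = \<bar>r\<bar> * gauge_K x"
proof (cases "r = 0")
  case True
  then show ?thesis by (simp add: gauge_K_0)
next
  case False
  \<comment> \<open>The reverse inequality is the same bound applied to
    \<open>inverse r\<close>.\<close>
  have "gauge_K (inverse r *\<^sub>R (r *\<^sub>R x)) \<le> \<bar>inverse r\<bar> * gauge_K (r *\<^sub>R x)"
    using assms False by (intro gauge_K_scale_le Rd_scale) auto
  then have "\<bar>r\<bar> * gauge_K x \<le> gauge_K (r *\<^sub>R x)"
    using False by (simp add: field_simps)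
  with gauge_K_scale_le[OF assms False] show ?thesis by simp
qed

sublocale Rd_norm d gauge_K
proof
  show "\<exists>\<delta>>0. \<forall>x\<in>Rd d. (\<forall>i<d. \<bar>x i\<bar> \<le> \<delta>) \<longrightarrow> gauge_K x \<le> 1"
  proof -
    have "gauge_K x \<le> 1" if "x \<in> K" for x
      using that by (intro gauge_K_le) auto
    with K_box show ?thesis by meson
  qed
  obtain R where R: "R > 0" "\<And>x i. x \<in> K \<Longrightarrow> i < d \<Longrightarrow> \<bar>x i\<bar> \<le> R"
    using K_bounded by blast
  have "\<bar>x i\<bar> \<le> R * gauge_K x" if "x \<in> Rd d" "i < d" for x i
  proof -
    have "\<bar>x i\<bar> / R \<le> s" if s: "gauge_K x < s" for s
    proof -
      have "s > 0" using s gauge_K_nonneg[OF \<open>x \<in> Rd d\<close>] by linarith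
      obtain k where k: "k \<in> K" "x = s *\<^sub>R k"
        using mem_scale_K[OF \<open>x \<in> Rd d\<close> s] by blast
      have "\<bar>x i\<bar> = s * \<bar>k i\<bar>" using k \<open>s > 0\<close> by (simp add: abs_mult)
      also have "\<dots> \<le> s * R" using R(2)[OF k(1) \<open>i < d\<close>] \<open>s > 0\<close> by simp
      finally show ?thesis using R(1) by (simp add: divide_le_eq)
    qed
    then have "\<bar>x i\<bar> / R \<le> gauge_K x" by (rule dense_ge)
    then show ?thesis using R(1) by (simp add: divide_le_eq mult.commute)
  qed
  then show "\<exists>R. \<forall>x\<in>Rd d. \<forall>i<d. \<bar>x i\<bar> \<le> R * gauge_K x" by blast
qed (auto simp: gauge_K_add gauge_K_scale)

text \<open>Contracting a point of \<open>K\<close> strictly towards the origin leaves room for a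
  box, so a strict gauge bound reaches the interior. This turns the Minkowski condition into a lower
  bound on distances.\<close>

lemma mem_scale_int_K:
  assumes "x \<in> Rd d" "gauge_K x < r"
  shows "x \<in> (*\<^sub>R) r ` int_d d K"
proof -
  obtain s where s: "gauge_K x < s" "s < r"
    using assms(2) dense by blast
  have pos: "0 < s" "0 < r" using s gauge_K_nonneg[OF assms(1)] by linarith+
  obtain k where k: "k \<in> K" "x = s *\<^sub>R k"
    using mem_scale_K[OF assms(1) s(1)] by blast
  obtain \<delta> where \<delta>: "\<delta> > 0" "\<And>x. x \<in> Rd d \<Longrightarrow> (\<And>i. i < d \<Longrightarrow> \<bar>x i\<bar> \<le> \<delta>) \<Longrightarrow> x \<in> K"
    using K_box by blast
  define t where "t = s / r"
  have t: "0 < t" "t < 1" using s pos by (auto simp: t_def)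
  \<comment> \<open>This box around \<open>t *\<^sub>R k\<close> lies in \<open>K\<close>, because
    each of its points is a convex combination of \<open>k\<close> and a point of the box around the
    origin.\<close>
  define U where "U = {y \<in> Rd d. \<forall>i<d. \<bar>y i - (t *\<^sub>R k) i\<bar> < (1 - t) * \<delta>}"
  have kRd: "k \<in> Rd d" using k K_Rd by blast
  have "U \<subseteq> K"
  proof
    fix y assume y: "y \<in> U"
    define z where "z = (1 / (1 - t)) *\<^sub>R (y - t *\<^sub>R k)"
    have "z \<in> K"
    proof (rule \<delta>(2))
      show "z \<in> Rd d" using y kRd by (simp add: z_def U_def Rd_diff Rd_scale)
      fix i assume "i < d"
      with y have "\<bar>y i - t * k i\<bar> \<le> (1 - t) * \<delta>" by (auto simp: U_def)
      then show "\<bar>z i\<bar> \<le> \<delta>" using t by (simp add: z_def abs_mult divide_le_eq mult.commute)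
    qed
    then have "t *\<^sub>R k + (1 - t) *\<^sub>R z \<in> K"
      using t k by (intro convexD[OF convex_K]) auto
    also have "t *\<^sub>R k + (1 - t) *\<^sub>R z = y" using t by (simp add: z_def)
    finally show "y \<in> K" .
  qed
  moreover have "t *\<^sub>R k \<in> U"
    using t \<delta>(1) kRd by (simp add: U_def Rd_scale)
  moreover have "openin (top_of_set (Rd d)) U"
    unfolding U_def by (rule openin_Rd_box)
  ultimately have "t *\<^sub>R k \<in> int_d d K" by (auto simp: int_d_def)
  moreover have "x = r *\<^sub>R (t *\<^sub>R k)" using pos k by (simp add: t_def)
  ultimately show ?thesis by blast
qed

text \<open>A common point of two homothets bounds the distance of their centres by the sum of the
  ratios. A distance below \<open>lam j\<close> would put \<open>v i\<close> into the interior of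
  the homothet at \<open>v j\<close>.\<close>

lemma card_arrangement_le:
  assumes "finite I" "d \<ge> 2" "minkowski_arr d K I v lam" "pairwise_intersecting K I v lam"
  shows "real (card I) \<le> 4 * exp 2 * 3 ^ d * real d * ln (real d)"
proof (rule card_minkowski_le)
  show Rd: "v i \<in> Rd d" and lam: "0 < lam i" if "i \<in> I" for i
    using assms(3) that by (auto simp: minkowski_arr_def homothet_family_def)
  show "gauge_K (v i - v j) \<le> lam i + lam j" if ij: "i \<in> I" "j \<in> I" for i j
  proof -
    obtain k l where k: "k \<in> K" and l: "l \<in> K" and eq: "lam i *\<^sub>R k + v i = lam j *\<^sub>R l + v j"
      using assms(4) ij unfolding pairwise_intersecting_def homothet_eq by blast
    have "v i - v j = lam j *\<^sub>R l - lam i *\<^sub>R k"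
      using eq by (simp add: algebra_simps)
    then have "gauge_K (v i - v j) = gauge_K (lam j *\<^sub>R l - lam i *\<^sub>R k)"
      by simp
    also have "\<dots> \<le> gauge_K (lam j *\<^sub>R l) + gauge_K (lam i *\<^sub>R k)"
      using k l K_Rd by (intro N_diff Rd_scale) auto
    also have "\<dots> \<le> lam j + lam i"
      using k l lam ij by (intro add_mono gauge_K_le) auto
    finally show ?thesis by simp
  qed
  show "lam j \<le> gauge_K (v i - v j)" if ij: "i \<in> I" "j \<in> I" "i \<noteq> j" for i j
  proof (rule ccontr)
    assume "\<not> ?thesis"
    then obtain k where "k \<in> int_d d K" "v i - v j = lam j *\<^sub>R k"
      using mem_scale_int_K[of "v i - v j" "lam j"] Rd ij by (auto simp: Rd_diff)
    then have "v i \<in> homothet (v j) (lam j) (int_d d K)"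
      unfolding homothet_eq by (intro image_eqI[of _ _ k]) (auto simp: algebra_simps)
    with assms(3) ij show False by (auto simp: minkowski_arr_def)
  qed
qed (use assms in auto)

end

section \<open>From convex bodies to the bound on \<open>kappa\<close>\<close>

lemma sym_body_convex_body:
  assumes "convex_body d K" "o_symmetric K"
  shows "sym_body d K"
proof
  show K_Rd: "K \<subseteq> Rd d" and conv: "convex K"
    using assms(1) by (auto simp: convex_body_def convex_d_iff)
  show symm: "- x \<in> K" if "x \<in> K" for x
  proof -
    have "(\<lambda>i. - x i) \<in> K"
      using assms(2) that unfolding o_symmetric_def by blast
    moreover have "(\<lambda>i. - x i) = - x" by (auto simp: fun_eq_iff)
    ultimately show ?thesis by simp
  qed
  show "\<exists>\<delta>>0. \<forall>x\<in>Rd d. (\<forall>i<d. \<bar>x i\<bar> \<le> \<delta>) \<longrightarrow> x \<in> K"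
  proof -
    obtain p U where U: "openin (top_of_set (Rd d)) U" "p \<in> U" "U \<subseteq> K"
      using assms(1) by (auto simp: convex_body_def int_d_def)
    then obtain T where T: "open T" "U = Rd d \<inter> T"
      by (auto simp: openin_open)
    then obtain \<delta> where \<delta>: "\<delta> > 0" "\<And>x. x \<in> Rd d \<Longrightarrow> (\<And>i. i < d \<Longrightarrow> \<bar>x i\<bar> \<le> \<delta>) \<Longrightarrow> p + x \<in> T"
      using open_Rd_box[of T p d] U(2) by blast
    have "x \<in> K" if x: "x \<in> Rd d" "\<forall>i<d. \<bar>x i\<bar> \<le> \<delta>" for x
    proof -
      have "p \<in> K" "p + x \<in> K"
        using U T \<delta>(2)[of x] x by (auto intro: Rd_add)
      moreover have "p - x \<in> K"
        using U T \<delta>(2)[of "- x"] x Rd_neg[OF x(1)] Rd_diff[of p d x] by auto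
      \<comment> \<open>A box around an arbitrary interior point \<open>p\<close> is carried to the
        origin: \<open>x\<close> is the midpoint of \<open>p + x\<close> and the reflection of
        \<open>p - x\<close>.\<close>
      ultimately have "(1 / 2) *\<^sub>R (p + x) + (1 / 2) *\<^sub>R (- (p - x)) \<in> K"
        by (intro convexD[OF conv] symm) auto
      also have "(1 / 2) *\<^sub>R (p + x) + (1 / 2) *\<^sub>R (- (p - x)) = x"
        by (auto simp: fun_eq_iff field_simps)
      finally show ?thesis .
    qed
    with \<delta>(1) show ?thesis by blast
  qed
  show "\<exists>R>0. \<forall>x\<in>K. \<forall>i<d. \<bar>x i\<bar> \<le> R"
  proof -
    \<comment> \<open>Coordinate projections are continuous, so they map \<open>K\<close> to compact
      sets; summing the resulting bounds makes them uniform in \<open>i\<close>.\<close>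
    have "\<exists>R. \<forall>x\<in>K. \<bar>x i\<bar> \<le> R" for i
    proof -
      have "compact ((\<lambda>x. x i) ` K)"
        using assms(1) unfolding convex_body_def
        by (intro compact_continuous_image continuous_on_subset[OF continuous_on_product_coordinates subset_UNIV]) auto
      then show ?thesis
        by (auto dest!: compact_imp_bounded simp: bounded_iff)
    qed
    then obtain R where R: "\<And>i x. x \<in> K \<Longrightarrow> \<bar>x i\<bar> \<le> R i"
      by metis
    have "\<bar>x i\<bar> \<le> (\<Sum>j<d. \<bar>R j\<bar>) + 1" if "x \<in> K" "i < d" for x i
      using R[OF that(1), of i] member_le_sum[of i "{..<d}" "\<lambda>j. \<bar>R j\<bar>"] that(2) by simp
    moreover have "(\<Sum>j<d. \<bar>R j\<bar>) + 1 > 0"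
      by (simp add: add_nonneg_pos sum_nonneg)
    ultimately show ?thesis by blast
  qed
qed

lemma kappa'_le_kappa: "kappa' d K \<le> kappa d K"
proof -
  have "int_d d K \<subseteq> K" by (auto simp: int_d_def)
  then have "homothet v lam (int_d d K) \<subseteq> homothet v lam K" for v lam
    by (auto simp: homothet_def)
  then have "minkowski_arr d K I v lam" if "strict_minkowski_arr d K I v lam"
    for I :: "nat set" and v lam
    using that unfolding minkowski_arr_def strict_minkowski_arr_def by blast
  then show ?thesis
    unfolding kappa_def kappa'_def by (intro Sup_subset_mono) blast
qed

theorem theorem1:
  shows "\<exists>C::real. C > 0 \<and> (\<forall>d::nat. \<forall>K. d \<ge> 2 \<and> convex_body d K \<and> o_symmetric K \<longrightarrow>
           kappa' d K \<le> kappa d K \<and>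
           kappa d K \<le> ereal (C * 3 ^ d * real d * ln (real d)))"
proof (intro exI[of _ "4 * exp 2"] conjI allI impI)
  fix d :: nat and K :: "(nat \<Rightarrow> real) set"
  assume *: "d \<ge> 2 \<and> convex_body d K \<and> o_symmetric K"
  then interpret sym_body d K by (intro sym_body_convex_body) auto
  show "kappa' d K \<le> kappa d K" by (rule kappa'_le_kappa)
  \<comment> \<open>The bound is the same for every finite family, so it passes to the
    supremum.\<close>
  show "kappa d K \<le> ereal (4 * exp 2 * 3 ^ d * real d * ln (real d))"
    unfolding kappa_def using * card_arrangement_le by (intro Sup_least) auto
qed simp

end
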